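(* There exists a positive real $r_0$ such that the following holds for every positive integer $r$ and positive real $\alpha\le1$ with $(\log r)^\alpha\ge r_0$. For $n=2^{(\log r)^{2+\alpha}/200}$, there exists a partition $E=E_1\cup\dots\cup E_{\sqrt r}$ of the edge set of the complete graph $K_n$ such that \[ \chi(\mathcal{G}_I)\le 2^{3(\log r)^{\alpha/2}\sqrt{|I|\log 2|I|}} \] for all $I\subseteq[\sqrt r]$.
   Context: Logarithms are base 2; non-integer quantities such as $n$ and $\sqrt r$ are understood rounded to integers (the paper omits floor and ceiling signs), and some parts $E_i$ may be empty. For $I\subseteq[\sqrt r]$, $\mathcal{G}_I$ is the spanning subgraph of $K_n$ with edge set $\bigcup_{i\in I}E_i$; $\chi$ is chromatic number. *)

theory Defs
  imports Complex_Main
begin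

definition Kn_edges :: "nat \<Rightarrow> nat set set" where
  "Kn_edges n = {{u, v} | u v. u < n \<and> v < n \<and> u \<noteq> v}"

definition chromatic_number :: "nat \<Rightarrow> nat set set \<Rightarrow> nat" where
  "chromatic_number n F =
     (LEAST k. \<exists>c::nat \<Rightarrow> nat. (\<forall>v<n. c v < k) \<and>
        (\<forall>u<n. \<forall>v<n. {u, v} \<in> F \<and> u \<noteq> v \<longrightarrow> c u \<noteq> c v))"

end

theory Submission
  imports Defs "HOL-Library.FuncSet" "HOL-Analysis.Convex" "HOL-Real_Asymp.Real_Asymp"
begin

text \<open>Write \<open>L = log r\<close>. The vertices consist of about \<open>L^\<alpha> / 4\<close> layers, each a vector of about
  \<open>L / 5\<close> coordinates of about \<open>L / 9\<close> bits. An edge is coloured by a layer in which its ends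
  differ, the set \<open>S\<close> of all coordinates in which they differ there, one such coordinate \<open>i\<close>, and
  the two values at \<open>i\<close>.

  Consider \<open>s\<close> colours of one layer and a threshold \<open>d\<close>. As long as some position \<open>i\<close> lies in at
  least \<open>d\<close> of the sets \<open>S\<close>, branching on the value at \<open>i\<close> discards either \<open>d\<close> colours or, at no
  multiplicative cost, the colours with position \<open>i\<close>. Otherwise the colours fall into \<open>2 d\<close>
  classes without mutual interference, each of which gives a bipartite graph. Balancing \<open>2 ^ (2 d)\<close>
  against \<open>(1 + 2 s) ^ (1 + s / d)\<close> with \<open>d\<close> close to \<open>sqrt (s log (2 s))\<close> gives
  \<open>2 ^ (6 sqrt (s log (2 s)))\<close> for one layer, and the product colouring of all the layers is estimated
  by the Cauchy--Schwarz inequality.\<close>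

section \<open>Colourability\<close>

text \<open>The edges are an arbitrary relation on an arbitrary type because each layer is coloured
  on vectors, that is on functions, and only afterwards pulled back to
  \<open>{..<n}\<close>.\<close>

definition colourable :: "'v set \<Rightarrow> ('v \<Rightarrow> 'v \<Rightarrow> bool) \<Rightarrow> nat \<Rightarrow> bool" where
  "colourable X E k \<longleftrightarrow>
     (\<exists>f :: 'v \<Rightarrow> nat. (\<forall>v\<in>X. f v < k) \<and> (\<forall>u\<in>X. \<forall>v\<in>X. E u v \<longrightarrow> f u \<noteq> f v))"

lemma colourableI:
  fixes f :: "'v \<Rightarrow> 'c"
  assumes "finite C" "card C \<le> k" "\<And>v. v \<in> X \<Longrightarrow> f v \<in> C"
    and "\<And>u v. u \<in> X \<Longrightarrow> v \<in> X \<Longrightarrow> E u v \<Longrightarrow> f u \<noteq> f v"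
  shows "colourable X E k"
proof -
  obtain g :: "'c \<Rightarrow> nat" where g: "g ` C \<subseteq> {..<k}" "inj_on g C"
    using card_le_inj[OF assms(1), of "{..<k}"] assms(2) by auto
  show ?thesis
    unfolding colourable_def
  proof (intro exI[of _ "g \<circ> f"] conjI ballI impI)
    show "(g \<circ> f) v < k" if "v \<in> X" for v
      using g(1) assms(3)[OF that] by auto
    show "(g \<circ> f) u \<noteq> (g \<circ> f) v" if "u \<in> X" "v \<in> X" "E u v" for u v
      using assms(3,4) that g(2) by (auto dest: inj_onD)
  qed
qed

lemma colourable_mono:
  assumes "colourable X E k" "k \<le> k'" "Y \<subseteq> X"
    and "\<And>u v. u \<in> Y \<Longrightarrow> v \<in> Y \<Longrightarrow> F u v \<Longrightarrow> E u v"
  shows "colourable Y F k'"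
proof -
  obtain f :: "'a \<Rightarrow> nat" where f: "\<forall>v\<in>X. f v < k" "\<forall>u\<in>X. \<forall>v\<in>X. E u v \<longrightarrow> f u \<noteq> f v"
    using assms(1) unfolding colourable_def by blast
  show ?thesis
    unfolding colourable_def
  proof (intro exI[of _ f] conjI ballI impI)
    show "f v < k'" if "v \<in> Y" for v
      using f(1) assms(2,3) that by (meson less_le_trans subsetD)
    show "f u \<noteq> f v" if "u \<in> Y" "v \<in> Y" "F u v" for u v
      using f(2) assms(3,4) that by blast
  qed
qed

lemma colourable_Un:
  assumes "colourable X E k" "colourable Y E l"
  shows "colourable (X \<union> Y) E (k + l)"
proof -
  obtain f :: "'a \<Rightarrow> nat" where f: "\<forall>v\<in>X. f v < k" "\<forall>u\<in>X. \<forall>v\<in>X. E u v \<longrightarrow> f u \<noteq> f v"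
    using assms(1) unfolding colourable_def by blast
  obtain g :: "'a \<Rightarrow> nat" where g: "\<forall>v\<in>Y. g v < l" "\<forall>u\<in>Y. \<forall>v\<in>Y. E u v \<longrightarrow> g u \<noteq> g v"
    using assms(2) unfolding colourable_def by blast
  define h where "h v = (if v \<in> X then f v else k + g v)" for v
  show ?thesis
    unfolding colourable_def
  proof (intro exI[of _ h] conjI ballI impI)
    show "h v < k + l" if "v \<in> X \<union> Y" for v
      using f(1) g(1) that by (auto simp: h_def intro: trans_less_add1)
    show "h u \<noteq> h v" if "u \<in> X \<union> Y" "v \<in> X \<union> Y" "E u v" for u v
      using f g that by (auto simp: h_def)
  qed
qed

text \<open>Pairing \<open>h v\<close> with a colouring of its fibre separates all edges between
  different fibres. This is the branching on a coordinate value.\<close>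

lemma colourable_fibres:
  fixes h :: "'v \<Rightarrow> 'b"
  assumes "finite V" "\<And>x. x \<in> V \<Longrightarrow> colourable {v \<in> X. h v = x} E k"
  shows "colourable {v \<in> X. h v \<in> V} E (card V * k)"
proof -
  have "\<forall>x\<in>V. \<exists>f :: 'v \<Rightarrow> nat. (\<forall>v\<in>{v \<in> X. h v = x}. f v < k) \<and>
      (\<forall>u\<in>{v \<in> X. h v = x}. \<forall>v\<in>{v \<in> X. h v = x}. E u v \<longrightarrow> f u \<noteq> f v)"
    using assms(2) unfolding colourable_def by blast
  from bchoice[OF this] obtain f :: "'b \<Rightarrow> 'v \<Rightarrow> nat" where f:
    "\<forall>x\<in>V. (\<forall>v\<in>{v \<in> X. h v = x}. f x v < k) \<and>
      (\<forall>u\<in>{v \<in> X. h v = x}. \<forall>v\<in>{v \<in> X. h v = x}. E u v \<longrightarrow> f x u \<noteq> f x v)"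
    by blast
  show ?thesis
    by (rule colourableI[where C = "V \<times> {..<k}" and f = "\<lambda>v. (h v, f (h v) v)"])
      (use assms(1) f in \<open>auto simp: card_cartesian_product\<close>)
qed

text \<open>In the tuple of the given colourings, component \<open>e\<close> separates the ends of
  an edge of \<open>E e\<close>.\<close>

lemma colourable_prod:
  assumes "finite T" "\<And>e. e \<in> T \<Longrightarrow> colourable X (E e) (k e)"
  shows "colourable X (\<lambda>u v. \<exists>e\<in>T. E e u v) (\<Prod>e\<in>T. k e)"
proof -
  have "\<forall>e\<in>T. \<exists>f :: 'b \<Rightarrow> nat. (\<forall>v\<in>X. f v < k e) \<and> (\<forall>u\<in>X. \<forall>v\<in>X. E e u v \<longrightarrow> f u \<noteq> f v)"
    using assms(2) unfolding colourable_def by blast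
  from bchoice[OF this] obtain f :: "'a \<Rightarrow> 'b \<Rightarrow> nat" where f:
    "\<forall>e\<in>T. (\<forall>v\<in>X. f e v < k e) \<and> (\<forall>u\<in>X. \<forall>v\<in>X. E e u v \<longrightarrow> f e u \<noteq> f e v)"
    by blast
  show ?thesis
  proof (rule colourableI[where C = "PiE T (\<lambda>e. {..<k e})" and f = "\<lambda>v. \<lambda>e\<in>T. f e v"])
    show "(\<lambda>e\<in>T. f e u) \<noteq> (\<lambda>e\<in>T. f e v)" if "u \<in> X" "v \<in> X" "\<exists>e\<in>T. E e u v" for u v
      using that f by (metis restrict_apply')
  qed (use assms(1) f in \<open>auto simp: card_PiE intro!: finite_PiE\<close>)
qed

text \<open>Greedy colouring by degeneracy: if all in-degrees are below \<open>d\<close>, so is some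
  out-degree. That element has fewer than \<open>2 * d\<close> neighbours in both directions
  together, and the hypothesis survives its removal.\<close>

lemma indegree_partition:
  fixes R :: "'c \<Rightarrow> 'c \<Rightarrow> bool"
  assumes "finite A" "\<And>b. b \<in> A \<Longrightarrow> card {a \<in> A. R a b} < d"
  shows "\<exists>f :: 'c \<Rightarrow> nat. (\<forall>a\<in>A. f a < 2 * d) \<and>
    (\<forall>a\<in>A. \<forall>b\<in>A. a \<noteq> b \<longrightarrow> f a = f b \<longrightarrow> \<not> R a b)"
  using assms
proof (induction "card A" arbitrary: A)
  case 0
  then show ?case by auto
next
  case (Suc m)
  have ne: "A \<noteq> {}" using Suc.hyps(2) by auto
  \<comment> \<open>Double counting of the related pairs: out-degrees all at least \<open>d\<close>
    would make the left sum too large.\<close>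
  have "(\<Sum>a\<in>A. card {b \<in> A. R a b}) = (\<Sum>b\<in>A. card {a \<in> A. R a b})"
    using Suc.prems(1) by (intro sum_multicount_gen) auto
  also have "\<dots> < (\<Sum>b\<in>A. d)"
    using Suc.prems ne by (intro sum_strict_mono) auto
  finally obtain a where a: "a \<in> A" "card {b \<in> A. R a b} < d"
    by (meson not_less sum_mono)
  define A' where "A' = A - {a}"
  have A': "finite A'" "m = card A'" "A = insert a A'" "a \<notin> A'"
    using Suc.prems(1) Suc.hyps(2) a(1) by (auto simp: A'_def)
  have "card {c \<in> A'. R c b} < d" if "b \<in> A'" for b
    using Suc.prems(2)[of b] that A'(3) card_mono[of "{c \<in> A. R c b}" "{c \<in> A'. R c b}"] Suc.prems(1)
    by fastforce
  from Suc.hyps(1)[OF A'(2,1) this] obtain f :: "'c \<Rightarrow> nat" where f: "\<forall>a\<in>A'. f a < 2 * d"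
    "\<forall>a\<in>A'. \<forall>b\<in>A'. a \<noteq> b \<longrightarrow> f a = f b \<longrightarrow> \<not> R a b" by blast
  define N where "N = {b \<in> A. R a b} \<union> {b \<in> A. R b a}"
  have "card (f ` N) \<le> card N" "card N \<le> card {b \<in> A. R a b} + card {b \<in> A. R b a}"
    using Suc.prems(1) by (auto simp: N_def card_Un_le intro!: card_image_le)
  then have "card (f ` N) < card {..<2 * d}"
    using a Suc.prems(2)[OF a(1)] by simp
  moreover have "finite (f ` N)"
    using Suc.prems(1) by (simp add: N_def)
  ultimately have "\<not> {..<2 * d} \<subseteq> f ` N"
    using card_mono not_less by blast
  then obtain k where k: "k < 2 * d" "k \<notin> f ` N" by blast
  show ?case
    using f k A'(3,4) by (intro exI[of _ "f(a := k)"]) (auto simp: N_def)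
qed

section \<open>A single layer\<close>

type_synonym colour = "nat \<times> nat \<times> nat \<times> nat set"

abbreviation pos :: "colour \<Rightarrow> nat" where "pos c \<equiv> fst c"
abbreviation val1 :: "colour \<Rightarrow> nat" where "val1 c \<equiv> fst (snd c)"
abbreviation val2 :: "colour \<Rightarrow> nat" where "val2 c \<equiv> fst (snd (snd c))"
abbreviation dset :: "colour \<Rightarrow> nat set" where "dset c \<equiv> snd (snd (snd c))"

text \<open>The values are compared as an unordered pair, which makes the relation symmetric.
  Recording the whole difference set guarantees that the ends of an edge of colour \<open>c\<close>
  agree at every position outside \<open>dset c\<close>.\<close>

definition joins :: "colour \<Rightarrow> (nat \<Rightarrow> nat) \<Rightarrow> (nat \<Rightarrow> nat) \<Rightarrow> bool" where
  "joins c u v \<longleftrightarrow> u (pos c) \<noteq> v (pos c) \<and> {u (pos c), v (pos c)} = {val1 c, val2 c} \<and>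
     dset c = {j. u j \<noteq> v j}"

abbreviation joined :: "colour set \<Rightarrow> (nat \<Rightarrow> nat) \<Rightarrow> (nat \<Rightarrow> nat) \<Rightarrow> bool" where
  "joined A u v \<equiv> \<exists>c\<in>A. joins c u v"

text \<open>If no two colours see each other's position, an edge changes exactly one summand of the
  parity used as colouring.\<close>

lemma colourable_independent_colours:
  assumes "finite A" "\<And>a b. a \<in> A \<Longrightarrow> b \<in> A \<Longrightarrow> a \<noteq> b \<Longrightarrow> pos b \<notin> dset a"
  shows "colourable X (joined A) 2"
proof (rule colourableI[where C = "UNIV :: bool set"
      and f = "\<lambda>v. even (\<Sum>c\<in>A. if v (pos c) = val2 c then 1 else 0 :: nat)"])
  fix u v
  assume "joined A u v"
  then obtain c where c: "c \<in> A" "joins c u v" by blast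
  let ?g = "\<lambda>w b. if w (pos b) = val2 b then 1 else 0 :: nat"
  have same: "(\<Sum>b\<in>A - {c}. ?g u b) = (\<Sum>b\<in>A - {c}. ?g v b)"
  proof (rule sum.cong)
    fix b assume "b \<in> A - {c}"
    then have "pos b \<notin> dset c" using assms(2)[OF c(1), of b] by blast
    then show "?g u b = ?g v b" using c(2) by (auto simp: joins_def)
  qed simp
  have split: "(\<Sum>b\<in>A. ?g w b) = ?g w c + (\<Sum>b\<in>A - {c}. ?g w b)" for w
    using assms(1) c(1) by (rule sum.remove)
  \<comment> \<open>The two ends take distinct values forming the pair of \<open>c\<close>, so
    exactly one of them takes \<open>val2 c\<close>.\<close>
  have "(u (pos c) = val2 c) \<noteq> (v (pos c) = val2 c)"
    using c(2) by (auto simp: joins_def doubleton_eq_iff)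
  then show "even (\<Sum>b\<in>A. ?g u b) \<noteq> even (\<Sum>b\<in>A. ?g v b)"
    unfolding split same
    by (cases "u (pos c) = val2 c"; cases "v (pos c) = val2 c") simp_all
qed auto

text \<open>Relate \<open>a\<close> to \<open>b\<close> when edges of colour \<open>a\<close> change
  position \<open>pos b\<close>. The in-degrees are below \<open>d\<close>, so there are
  \<open>2 * d\<close> classes without interference; each costs a factor 2 in the product
  colouring.\<close>

lemma colourable_sparse_colours:
  assumes "finite A" "\<And>b. b \<in> A \<Longrightarrow> card {a \<in> A. pos b \<in> dset a} < d"
  shows "colourable X (joined A) (2 ^ (2 * d))"
proof -
  obtain f :: "colour \<Rightarrow> nat" where f: "\<forall>a\<in>A. f a < 2 * d"
    "\<forall>a\<in>A. \<forall>b\<in>A. a \<noteq> b \<longrightarrow> f a = f b \<longrightarrow> pos b \<notin> dset a"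
    using indegree_partition[of A "\<lambda>a b. pos b \<in> dset a" d] assms by blast
  have "colourable X (\<lambda>u v. \<exists>t\<in>{..<2 * d}. joined {c \<in> A. f c = t} u v) (\<Prod>t<2 * d. 2)"
    using f(2) assms(1) by (intro colourable_prod colourable_independent_colours) auto
  then show ?thesis
    by (rule colourable_mono) (use f(1) in \<open>auto simp del: split_paired_Ex\<close>)
qed

text \<open>If the position \<open>j\<close> of some colour lies in at least \<open>d\<close> of the difference sets, split the
  vertices by their value at \<open>j\<close>. Vertices sharing a value at \<open>j\<close> are not joined by these \<open>d\<close>
  colours; vertices whose value is in no pair prescribed at \<open>j\<close> are not joined by the colours with
  position \<open>j\<close>.\<close>

lemma colourable_layer:
  assumes "finite A" "card A \<le> s" "d > 0"
  shows "colourable X (joined A) (2 ^ (2 * d) * ((1 + 2 * card A) * (1 + 2 * s) ^ (card A div d)))"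
  using assms(1,2)
proof (induction "card A" arbitrary: A X rule: less_induct)
  case less
  show ?case
  proof (cases "\<exists>b\<in>A. card {a \<in> A. pos b \<in> dset a} \<ge> d")
    case False
    then have "colourable X (joined A) (2 ^ (2 * d))"
      by (intro colourable_sparse_colours less.prems) (auto simp: not_le)
    then show ?thesis
      by (rule colourable_mono) (auto simp: Suc_le_eq)
  next
    case True
    then obtain b where b: "b \<in> A" "card {a \<in> A. pos b \<in> dset a} \<ge> d" by blast
    define j where "j = pos b"
    define D where "D = {c \<in> A. j \<in> dset c}"
    define P where "P = {c \<in> A. pos c = j}"
    define V where "V = val1 ` P \<union> val2 ` P"
    \<comment> \<open>The base keeps the fixed \<open>s\<close>, so that bounds for different
      subsets of \<open>A\<close> can be compared.\<close>
    define g where "g n = 2 ^ (2 * d) * ((1 + 2 * n) * (1 + 2 * s) ^ (n div d))" for n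
    have fin: "finite D" "finite P" "D \<subseteq> A" "P \<subseteq> A" "b \<in> P"
      using less.prems(1) b(1) by (auto simp: D_def P_def j_def)
    have cP: "card P > 0" using fin by (auto simp: card_gt_0_iff)
    have cD: "card D \<ge> d" using b(2) by (simp add: D_def j_def)
    have cle: "card D \<le> card A" "card P \<le> card A"
      using fin less.prems(1) by (auto intro: card_mono)
    have cA: "card (A - P) = card A - card P" "card (A - D) = card A - card D"
      using fin by (auto intro: card_Diff_subset)
    have lt: "card (A - P) < card A" "card (A - D) < card A"
      using cA cle cP cD assms(3) by auto
    have V: "finite V" "card V \<le> 2 * card P"
      using card_Un_le[of "val1 ` P" "val2 ` P"] card_image_le[OF fin(2), of val1]
        card_image_le[OF fin(2), of val2] fin(2) by (auto simp: V_def)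
    have "colourable {v \<in> X. v j \<notin> V} (joined (A - P)) (g (card (A - P)))"
      unfolding g_def using less.prems lt by (intro less.hyps) auto
    then have 1: "colourable {v \<in> X. v j \<notin> V} (joined A) (g (card (A - P)))"
    proof (rule colourable_mono)
      fix u v assume uv: "u \<in> {v \<in> X. v j \<notin> V}" "joined A u v"
      then obtain c where c: "c \<in> A" "joins c u v" by blast
      have "c \<notin> P"
      proof
        assume "c \<in> P"
        then have "u j \<in> V" using c(2) by (auto simp: joins_def P_def V_def doubleton_eq_iff)
        then show False using uv by simp
      qed
      then show "joined (A - P) u v" using c by blast
    qed auto
    have "colourable {v \<in> X. v j = x} (joined (A - D)) (g (card (A - D)))" for x
      unfolding g_def using less.prems lt by (intro less.hyps) auto
    then have "colourable {v \<in> X. v j = x} (joined A) (g (card (A - D)))" for x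
    proof (rule colourable_mono[OF _ order_refl order_refl])
      fix u v assume uv: "u \<in> {v \<in> X. v j = x}" "v \<in> {v \<in> X. v j = x}" "joined A u v"
      then obtain c where c: "c \<in> A" "joins c u v" by blast
      have "c \<notin> D" using c uv by (auto simp: joins_def D_def)
      then show "joined (A - D) u v" using c by blast
    qed
    then have 2: "colourable {v \<in> X. v j \<in> V} (joined A) (card V * g (card (A - D)))"
      by (intro colourable_fibres V)
    \<comment> \<open>Dropping \<open>D\<close> lowers the exponent by at least one, which absorbs
      the linear factor (at most \<open>1 + 2 * s\<close>) of each of the at most
      \<open>2 * card P\<close> fibres. Dropping \<open>P\<close> lowers the linear factor by
      \<open>2 * card P\<close>. The two contributions add up to exactly the claimed bound.\<close>
    let ?M = "(1 + 2 * s) ^ (card A div d)"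
    have gP: "g (card (A - P)) \<le> 2 ^ (2 * d) * ((1 + 2 * (card A - card P)) * ?M)"
      unfolding g_def cA(1) by (intro mult_le_mono power_increasing div_le_mono) auto
    have "g (card (A - D)) \<le> 2 ^ (2 * d) * ((1 + 2 * s) * (1 + 2 * s) ^ ((card A - d) div d))"
      unfolding g_def cA(2) using cD less.prems(2)
      by (intro mult_le_mono power_increasing div_le_mono) auto
    also have "(1 + 2 * s) * (1 + 2 * s) ^ ((card A - d) div d) = ?M"
      using cD cle(1) assms(3) by (simp add: le_div_geq flip: power_Suc)
    finally have "card V * g (card (A - D)) \<le> (2 * card P) * (2 ^ (2 * d) * ?M)"
      using V(2) by (intro mult_le_mono)
    with gP have "g (card (A - P)) + card V * g (card (A - D)) \<le>
        2 ^ (2 * d) * ((1 + 2 * (card A - card P)) * ?M) + (2 * card P) * (2 ^ (2 * d) * ?M)"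
      by (rule add_mono)
    also have "\<dots> = 2 ^ (2 * d) * ((1 + 2 * (card A - card P) + 2 * card P) * ?M)"
      by (simp add: algebra_simps)
    also have "1 + 2 * (card A - card P) + 2 * card P = 1 + 2 * card A"
      using cle(2) by simp
    finally show ?thesis
      by (intro colourable_mono[OF colourable_Un[OF 1 2]]) auto
  qed
qed

section \<open>Optimising the threshold\<close>

text \<open>For small \<open>s\<close> a threshold above \<open>s\<close> avoids branching altogether.\<close>

lemma layer_exponent_bound:
  fixes s :: nat
  assumes "s > 0"
  shows "\<exists>d>0. s < d \<and> real (2 ^ (2 * d)) \<le> 2 powr (6 * sqrt (s * log 2 (2 * s))) \<or>
    real (2 ^ (2 * d) * ((1 + 2 * s) * (1 + 2 * s) ^ (s div d))) \<le> 2 powr (6 * sqrt (s * log 2 (2 * s)))"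
proof -
  define l where "l = log 2 (2 * real s)"
  define t where "t = sqrt (s * l)"
  have l1: "l \<ge> 1" using assms by (simp add: l_def le_log_iff)
  have t2: "t\<^sup>2 = s * l" "t \<ge> 0" using l1 by (simp_all add: t_def)
  have "real s * 1 \<le> s * l" using l1 by (intro mult_left_mono) auto
  then have "t\<^sup>2 > 0" using assms t2(1) by linarith
  then have t0: "t > 0" using t2(2) by (cases "t = 0") auto
  show ?thesis
  proof (cases "s \<le> 6")
    case True
    \<comment> \<open>With \<open>d = s + 1\<close> the exponent \<open>2 * (s + 1)\<close> must be
      at most \<open>6 * t\<close>. Since \<open>l \<ge> 1\<close>, this inequality suffices; it
      holds up to \<open>s = 6\<close> and fails at 7.\<close>
    have "(real s + 1)\<^sup>2 \<le> 9 * s"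
    proof -
      have "s = 1 \<or> s = 2 \<or> s = 3 \<or> s = 4 \<or> s = 5 \<or> s = 6" using True assms by auto
      then show ?thesis by (auto simp: power2_eq_square)
    qed
    also have "\<dots> \<le> (3 * t)\<^sup>2" using \<open>real s * 1 \<le> s * l\<close> t2 by (simp add: power_mult_distrib)
    finally have "real s + 1 \<le> 3 * t" by (rule power2_le_imp_le) (use t2(2) in simp)
    then have "real (2 * (s + 1)) \<le> 6 * t" by simp
    then have "2 powr real (2 * (s + 1)) \<le> 2 powr (6 * t)" by (intro powr_mono) auto
    then have "real (2 ^ (2 * (s + 1))) \<le> 2 powr (6 * t)" by (subst (asm) powr_realpow) auto
    then show ?thesis by (intro exI[of _ "s + 1"]) (auto simp: t_def l_def)
  next
    case False
    \<comment> \<open>True from \<open>s = 7\<close> on. It yields \<open>l + 3 \<le> s\<close>,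
      hence \<open>1 + l \<le> t\<close>, which later absorbs the rounding of \<open>d\<close> and
      the extra factor of the power.\<close>
    have "2 * s \<le> 2 ^ (s - 3)"
    proof -
      have "2 * (n + 7) \<le> 2 ^ (n + 4)" for n :: nat by (induction n) (auto simp: power_add)
      from this[of "s - 7"] False show ?thesis by simp
    qed
    then have "real (2 * s) \<le> real (2 ^ (s - 3))" by (rule of_nat_mono)
    then have "2 * real s \<le> 2 powr real (s - 3)" by (simp add: powr_realpow)
    then have "l \<le> real s - 3" using False assms by (simp add: l_def log_le_iff of_nat_diff)
    have "(1 + l)\<^sup>2 \<le> t\<^sup>2"
    proof -
      have "(l + 3) * l \<le> s * l" using \<open>l \<le> real s - 3\<close> l1 by (intro mult_right_mono) auto
      then show ?thesis using l1 t2 by (simp add: power2_eq_square algebra_simps)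
    qed
    then have lt: "1 + l \<le> t" using t2(2) l1 by (simp add: power2_le_iff_abs_le)
    \<comment> \<open>The balanced threshold: \<open>2 * d\<close> costs at most
      \<open>2 * t + 2\<close>, and the power costs at most \<open>2 * l + 2 * t\<close> because
      \<open>l * s / t = t\<close>. With \<open>1 + l \<le> t\<close> the total is at most
      \<open>6 * t\<close>.\<close>
    define d where "d = nat \<lceil>t\<rceil>"
    have d: "real d \<ge> t" "real d \<le> t + 1" using t0 unfolding d_def by linarith+
    have d0: "d > 0" using d(1) t0 by linarith
    have "1 + 2 * real s \<le> (2 * real s)\<^sup>2"
    proof -
      have "1 * 1 \<le> real s * real s" using assms by (intro mult_mono) auto
      moreover have "real s * 1 \<le> real s * real s" using assms by (intro mult_mono) auto
      ultimately show ?thesis by (simp add: power2_eq_square)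
    qed
    also have "\<dots> = 2 powr (2 * l)"
    proof -
      have "2 powr (2 * l) = (2 powr l) powr 2" by (simp add: powr_powr mult.commute)
      also have "2 powr l = 2 * real s" using assms by (simp add: l_def)
      finally show ?thesis using assms by simp
    qed
    finally have M: "1 + 2 * real s \<le> 2 powr (2 * l)" .
    have "real (2 ^ (2 * d) * ((1 + 2 * s) * (1 + 2 * s) ^ (s div d))) =
        2 powr (2 * d) * (1 + 2 * real s) ^ (1 + s div d)"
    proof -
      have "2 powr (2 * d) = (2::real) ^ (2 * d)" by (subst powr_realpow[symmetric]) auto
      then show ?thesis by (simp add: distrib_right)
    qed
    also have "\<dots> \<le> 2 powr (2 * d) * (2 powr (2 * l)) ^ (1 + s div d)"
      using M by (intro mult_left_mono power_mono) auto
    also have "\<dots> = 2 powr (2 * d + 2 * l * real (1 + s div d))"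
      by (simp add: powr_add powr_power algebra_simps)
    also have "\<dots> \<le> 2 powr (6 * t)"
    proof (rule powr_mono)
      have "real (s div d) \<le> real s / real d" by (rule of_nat_div_le_of_nat)
      also have "\<dots> \<le> s / t" using d t0 by (intro divide_left_mono mult_pos_pos) auto
      finally have "l * real (s div d) \<le> l * (s / t)" using l1 by (intro mult_left_mono) auto
      also have "\<dots> = t" using t0 t2(1) by (simp add: field_simps power2_eq_square)
      finally have "2 * l * real (1 + s div d) \<le> 2 * l + 2 * t" by (simp add: algebra_simps)
      then show "2 * d + 2 * l * real (1 + s div d) \<le> 6 * t" using d(2) lt by simp
    qed simp
    finally show ?thesis using d0 by (intro exI[of _ d]) (auto simp: t_def l_def)
  qed
qed

text \<open>A threshold above \<open>card A\<close> makes the sparsity condition trivial; otherwise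
  the branching bound applies with \<open>s = card A\<close>. The empty set needs one colour,
  matching exponent 0.\<close>

lemma colourable_layer_sqrt:
  assumes "finite A"
  shows "\<exists>k. colourable X (joined A) k \<and>
    real k \<le> 2 powr (6 * sqrt (card A * log 2 (2 * card A)))"
proof (cases "A = {}")
  case True
  then have "colourable X (joined A) 1" by (auto simp: colourable_def intro: exI[of _ "\<lambda>_. 0"])
  then show ?thesis using True by (intro exI[of _ 1]) simp
next
  case False
  then have "card A > 0" using assms by auto
  from layer_exponent_bound[OF this] obtain d where d: "d > 0"
    "card A < d \<and> real (2 ^ (2 * d)) \<le> 2 powr (6 * sqrt (card A * log 2 (2 * card A))) \<or>
     real (2 ^ (2 * d) * ((1 + 2 * card A) * (1 + 2 * card A) ^ (card A div d)))
       \<le> 2 powr (6 * sqrt (card A * log 2 (2 * card A)))" by blast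
  have "colourable X (joined A) (2 ^ (2 * d))" if "card A < d"
  proof (rule colourable_sparse_colours[OF assms])
    show "card {a \<in> A. pos b \<in> dset a} < d" for b
      using that card_mono[of A "{a \<in> A. pos b \<in> dset a}"] assms by force
  qed
  then show ?thesis
    using d colourable_layer[OF assms order_refl d(1), of X] by blast
qed

section \<open>Combining the layers\<close>

text \<open>The map \<open>h\<close> need not be injective: it will project a vertex to one of its
  layers.\<close>

lemma colourable_vimage:
  assumes "colourable UNIV E k"
  shows "colourable X (\<lambda>u v. E (h u) (h v)) k"
proof -
  obtain f :: "'a \<Rightarrow> nat" where "\<forall>v. f v < k" "\<forall>u v. E u v \<longrightarrow> f u \<noteq> f v"
    using assms unfolding colourable_def by blast
  then show ?thesis
    unfolding colourable_def by (intro exI[of _ "f \<circ> h"]) auto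
qed

lemma chromatic_number_le:
  assumes "colourable {..<n} E k"
    and "\<And>u v. u < n \<Longrightarrow> v < n \<Longrightarrow> u \<noteq> v \<Longrightarrow> {u, v} \<in> F \<Longrightarrow> E u v"
  shows "chromatic_number n F \<le> k"
proof -
  obtain f :: "nat \<Rightarrow> nat" where f: "\<forall>v\<in>{..<n}. f v < k"
    "\<forall>u\<in>{..<n}. \<forall>v\<in>{..<n}. E u v \<longrightarrow> f u \<noteq> f v"
    using assms(1) unfolding colourable_def by blast
  show ?thesis
    unfolding chromatic_number_def
    by (rule Least_le) (use f assms(2) in \<open>auto intro!: exI[of _ f]\<close>)
qed

text \<open>Each logarithm is at most that of \<open>s\<close>; what remains is a sum of square
  roots, to which Cauchy--Schwarz applies.\<close>

lemma sum_sqrt_log_le: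
  fixes a :: "nat \<Rightarrow> nat"
  assumes "(\<Sum>e<l. a e) \<le> s"
  shows "(\<Sum>e<l. sqrt (a e * log 2 (2 * a e))) \<le> sqrt l * sqrt (s * log 2 (2 * s))"
proof -
  define L where "L = log 2 (2 * real s)"
  \<comment> \<open>The case \<open>s = 0\<close> rests on the convention for the logarithm at
    0.\<close>
  have L0: "L \<ge> 0" by (cases "s = 0") (auto simp: L_def log_def)
  have "sqrt (a e * log 2 (2 * a e)) \<le> sqrt (a e) * sqrt L" if "e < l" for e
  proof (cases "a e = 0")
    case False
    have "a e \<le> (\<Sum>e<l. a e)" using that by (intro member_le_sum) auto
    then have "a e \<le> s" using assms by simp
    then have "log 2 (2 * a e) \<le> L" using False by (simp add: L_def)
    then show ?thesis
      unfolding real_sqrt_mult[symmetric] by (intro real_sqrt_le_mono mult_left_mono) auto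
  qed (simp add: L0)
  then have "(\<Sum>e<l. sqrt (a e * log 2 (2 * a e))) \<le> (\<Sum>e<l. sqrt (a e) * sqrt L)"
    by (intro sum_mono) auto
  also have "\<dots> = (\<Sum>e<l. sqrt (a e)) * sqrt L"
    by (simp add: sum_distrib_right)
  also have "\<dots> \<le> sqrt (real s * real l) * sqrt L"
  proof (rule mult_right_mono[OF real_le_rsqrt])
    have "(\<Sum>e<l. sqrt (a e))\<^sup>2 \<le> (\<Sum>e<l. (sqrt (a e))\<^sup>2) * real (card {..<l})"
      by (rule sum_squared_le_sum_of_squares)
    also have "\<dots> = real (\<Sum>e<l. a e) * l" by simp
    also have "\<dots> \<le> real s * l" using assms by (intro mult_right_mono of_nat_mono) auto
    finally show "(\<Sum>e<l. sqrt (a e))\<^sup>2 \<le> real s * l" .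
  qed (use L0 in simp)
  also have "\<dots> = sqrt l * sqrt (s * L)" by (simp add: real_sqrt_mult mult_ac)
  finally show ?thesis by (simp only: L_def)
qed

lemma joins_commute: "joins c u v \<longleftrightarrow> joins c v u"
  by (auto simp: joins_def)

text \<open>Vertices are encoded injectively as \<open>l\<close> layers of \<open>B\<close>
  coordinates with \<open>q\<close> values each. The second hypothesis counts layer, position, two
  values and difference set, so these data can be numbered within \<open>{1..m}\<close>.\<close>

lemma exists_layered_colouring:
  fixes n m l B q :: nat
  assumes "n \<le> (q ^ B) ^ l" "l * (B * (q * (q * 2 ^ B))) \<le> m"
  shows "\<exists>col :: nat set \<Rightarrow> nat. (\<forall>e\<in>Kn_edges n. col e \<in> {1..m}) \<and>
    (\<forall>I\<subseteq>{1..m}. real (chromatic_number n {e \<in> Kn_edges n. col e \<in> I})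
       \<le> 2 powr (6 * (sqrt l * sqrt (card I * log 2 (2 * card I)))))"
proof -
  define W where "W = {..<l} \<rightarrow>\<^sub>E ({..<B} \<rightarrow>\<^sub>E {..<q})"
  define C where "C = {..<l} \<times> {..<B} \<times> {..<q} \<times> {..<q} \<times> Pow {..<B}"
  have "finite W" "card W = (q ^ B) ^ l"
    by (auto simp: W_def card_PiE intro!: finite_PiE)
  then obtain h where h: "h ` {..<n} \<subseteq> W" "inj_on h {..<n}"
    using card_le_inj[of "{..<n}" W] assms(1) by auto
  have finC: "finite C" "card C = l * (B * (q * (q * 2 ^ B)))"
    by (auto simp: C_def card_cartesian_product card_Pow)
  then obtain g where g: "g ` C \<subseteq> {1..m}" "inj_on g C"
    using card_le_inj[of C "{1..m}"] assms(2) by auto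
  \<comment> \<open>An edge is an unordered pair, so the chosen colour has to work for both orders
    of its ends.\<close>
  have "\<exists>z\<in>C. \<forall>u v. e = {u, v} \<longrightarrow> joins (snd z) (h u (fst z)) (h v (fst z))"
    if e: "e \<in> Kn_edges n" for e
  proof -
    obtain u v where uv: "e = {u, v}" "u < n" "v < n" "u \<noteq> v"
      using e unfolding Kn_edges_def by blast
    have W: "h u \<in> W" "h v \<in> W" "h u \<noteq> h v"
      using h uv by (auto dest: inj_onD)
    have "\<exists>t<l. h u t \<noteq> h v t"
    proof (rule ccontr)
      assume "\<not> (\<exists>t<l. h u t \<noteq> h v t)"
      then have "h u = h v"
        using W(1,2) unfolding W_def by (intro PiE_ext) auto
      then show False using W(3) by simp
    qed
    then obtain t where t: "t < l" "h u t \<noteq> h v t" by blast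
    have R: "h u t \<in> {..<B} \<rightarrow>\<^sub>E {..<q}" "h v t \<in> {..<B} \<rightarrow>\<^sub>E {..<q}"
      using W t(1) by (auto simp: W_def)
    \<comment> \<open>Both vectors are \<open>undefined\<close> outside \<open>{..<B}\<close>, so
      the difference set over all of \<open>nat\<close> lies in \<open>{..<B}\<close> and the colour
      is one of the finitely many in \<open>C\<close>.\<close>
    have out: "h u t i = h v t i" if "\<not> i < B" for i
      using PiE_arb[OF R(1), of i] PiE_arb[OF R(2), of i] that by simp
    obtain i where i: "i < B" "h u t i \<noteq> h v t i"
      using t(2) out by blast
    define c where "c = (i, h u t i, h v t i, {j. h u t j \<noteq> h v t j})"
    have j: "joins c (h u t) (h v t)"
      using i(2) by (auto simp: joins_def c_def)
    have "h u t i < q" "h v t i < q" using PiE_mem[OF R(1), of i] PiE_mem[OF R(2), of i] i(1) by simp_all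
    then have "(t, c) \<in> C"
      using i(1) t(1) out by (auto simp: C_def c_def)
    moreover have "joins c (h u' t) (h v' t)" if "e = {u', v'}" for u' v'
      using j uv(1) that joins_commute[of c "h u t" "h v t"] by (auto simp: doubleton_eq_iff)
    ultimately show ?thesis
      by (intro bexI[of _ "(t, c)"]) auto
  qed
  then obtain z where z: "\<And>e. e \<in> Kn_edges n \<Longrightarrow> z e \<in> C"
    "\<And>u v. {u, v} \<in> Kn_edges n \<Longrightarrow> joins (snd (z {u, v})) (h u (fst (z {u, v}))) (h v (fst (z {u, v})))"
    by metis
  show ?thesis
  proof (intro exI[of _ "\<lambda>e. g (z e)"] conjI ballI allI impI)
    show "g (z e) \<in> {1..m}" if "e \<in> Kn_edges n" for e
      using g(1) z(1)[OF that] by blast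
  next
    fix I :: "nat set"
    assume I: "I \<subseteq> {1..m}"
    define A where "A t = {c. (t, c) \<in> C \<and> g (t, c) \<in> I}" for t
    have finA: "finite (A t)" for t
    proof (rule finite_subset)
      show "A t \<subseteq> snd ` C" by (force simp: A_def)
    qed (simp add: finC)
    define K where "K t = 2 powr (6 * sqrt (card (A t) * log 2 (2 * card (A t))))" for t
    have "\<forall>t. \<exists>k. colourable UNIV (joined (A t)) k \<and> real k \<le> K t"
      unfolding K_def by (intro allI colourable_layer_sqrt finA)
    from choice[OF this] obtain k where
      k: "\<And>t. colourable UNIV (joined (A t)) (k t)" "\<And>t. real (k t) \<le> K t"
      by blast
    have "colourable {..<n} (\<lambda>u v. \<exists>t\<in>{..<l}. joined (A t) (h u t) (h v t)) (\<Prod>t<l. k t)"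
    proof (rule colourable_prod)
      show "colourable {..<n} (\<lambda>u v. joined (A t) (h u t) (h v t)) (k t)" for t
        using colourable_vimage[OF k(1)[of t], of "{..<n}" "\<lambda>v. h v t"] .
    qed simp
    then have "chromatic_number n {e \<in> Kn_edges n. g (z e) \<in> I} \<le> (\<Prod>t<l. k t)"
    proof (rule chromatic_number_le)
      fix u v assume e: "{u, v} \<in> {e \<in> Kn_edges n. g (z e) \<in> I}"
      obtain t c where tc: "z {u, v} = (t, c)" by (metis surj_pair)
      have "(t, c) \<in> C" using z(1)[of "{u, v}"] e tc by simp
      moreover from this have "t < l" by (auto simp: C_def)
      moreover have "c \<in> A t" using calculation(1) e tc by (simp add: A_def)
      moreover have "joins c (h u t) (h v t)" using z(2)[of u v] e tc by simp
      ultimately show "\<exists>t\<in>{..<l}. joined (A t) (h u t) (h v t)" by blast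
    qed
    then have "real (chromatic_number n {e \<in> Kn_edges n. g (z e) \<in> I}) \<le> (\<Prod>t<l. real (k t))"
      by (metis of_nat_le_iff of_nat_prod)
    also have "\<dots> \<le> (\<Prod>t<l. K t)"
      using k(2) by (intro prod_mono) auto
    also have "\<dots> = 2 powr (6 * (\<Sum>t<l. sqrt (card (A t) * log 2 (2 * card (A t)))))"
      by (simp add: K_def powr_sum sum_distrib_left)
    also have "\<dots> \<le> 2 powr (6 * (sqrt l * sqrt (card I * log 2 (2 * card I))))"
    proof -
      \<comment> \<open>The colours of \<open>I\<close> are shared out among the layers:
        \<open>g\<close> injects the disjoint union of the sets \<open>A t\<close> into
        \<open>I\<close>, so their sizes sum to at most \<open>card I\<close>.\<close>
      have sub: "Sigma {..<l} A \<subseteq> C" by (auto simp: A_def)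
      have "(\<Sum>t<l. card (A t)) = card (Sigma {..<l} A)"
        using finA by simp
      also have "\<dots> = card (g ` Sigma {..<l} A)"
        using g(2) sub by (metis card_image inj_on_subset)
      also have "\<dots> \<le> card I"
        using I by (intro card_mono) (auto simp: A_def intro: finite_subset)
      finally show ?thesis using sum_sqrt_log_le[of "\<lambda>t. card (A t)" l "card I"] by simp
    qed
    finally show "real (chromatic_number n {e \<in> Kn_edges n. g (z e) \<in> I})
      \<le> 2 powr (6 * (sqrt l * sqrt (card I * log 2 (2 * card I))))" .
  qed
qed

section \<open>Choice of parameters\<close>

theorem theorem3p3:
  shows "\<exists>r0::real. r0 > 0 \<and>
    (\<forall>(r::nat) (\<alpha>::real). r > 0 \<longrightarrow> 0 < \<alpha> \<longrightarrow> \<alpha> \<le> 1 \<longrightarrow>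
       (log 2 (real r)) powr \<alpha> \<ge> r0 \<longrightarrow>
       (let n = nat \<lfloor>2 powr ((log 2 (real r)) powr (2 + \<alpha>) / 200)\<rfloor>;
            m = nat \<lfloor>sqrt (real r)\<rfloor>
        in \<exists>col :: nat set \<Rightarrow> nat.
             (\<forall>e \<in> Kn_edges n. col e \<in> {1..m}) \<and>
             (\<forall>I \<subseteq> {1..m}.
                real (chromatic_number n {e \<in> Kn_edges n. col e \<in> I})
                  \<le> 2 powr (3 * (log 2 (real r)) powr (\<alpha> / 2)
                        * sqrt (real (card I) * log 2 (2 * real (card I)))))))"
proof -
  \<comment> \<open>The exponent is \<open>7 / 90 = 1 / 2 - 19 / 45\<close>, the room left in
    \<open>sqrt r\<close> after the factors \<open>2 ^ a\<close>, \<open>2 ^ a\<close>,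
    \<open>2 ^ B\<close> with \<open>2 / 9 + 1 / 5 = 19 / 45\<close>. The 8 pays for rounding up
    twice \<open>a\<close> and once \<open>B\<close>.\<close>
  have "eventually (\<lambda>L::real. 8 * L\<^sup>2 \<le> 2 powr (7 / 90 * L)) at_top"
    by real_asymp
  then obtain L0 :: real where L0: "\<And>L. L \<ge> L0 \<Longrightarrow> 8 * L\<^sup>2 \<le> 2 powr (7 / 90 * L)"
    by (auto simp: eventually_at_top_linorder)
  show ?thesis
  \<comment> \<open>From 40 on, \<open>\<mu> / 200 \<le> (\<mu> / 4 - 1) / 45\<close>, which makes
    room for \<open>n\<close> vertices despite rounding the number of layers down.\<close>
  proof (intro exI[of _ "max 40 L0"] conjI allI impI)
    fix r :: nat and \<alpha> :: real
    assume r: "r > 0" and \<alpha>: "0 < \<alpha>" "\<alpha> \<le> 1" and large: "max 40 L0 \<le> log 2 (real r) powr \<alpha>"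
    define L where "L = log 2 (real r)"
    define \<mu> where "\<mu> = L powr \<alpha>"
    have \<mu>: "\<mu> \<ge> 40" "\<mu> \<ge> L0" using large by (auto simp: \<mu>_def L_def)
    have "L \<ge> 0" using r by (simp add: L_def)
    have L1: "L \<ge> 1"
    proof (rule ccontr)
      assume "\<not> L \<ge> 1"
      then have "\<mu> \<le> 1" using \<open>L \<ge> 0\<close> \<alpha> by (simp add: \<mu>_def powr_le1)
      then show False using \<mu> by simp
    qed
    have "\<mu> \<le> L powr 1" unfolding \<mu>_def using L1 \<alpha> by (intro powr_mono) auto
    then have \<mu>L: "\<mu> \<le> L" using L1 by simp
    \<comment> \<open>There are \<open>l\<close> layers of \<open>B\<close> coordinates with
      \<open>a\<close> bits each, so \<open>q = 2 ^ a\<close>. The 4 in \<open>l\<close> turns the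
      constant 6 of a single layer into the required 3.\<close>
    define a where "a = nat \<lceil>L / 9\<rceil>"
    define B where "B = nat \<lceil>L / 5\<rceil>"
    define l where "l = nat \<lfloor>\<mu> / 4\<rfloor>"
    have a: "real a \<ge> L / 9" "real a \<le> L / 9 + 1" using L1 unfolding a_def by linarith+
    have B: "real B \<ge> L / 5" "real B \<le> L / 5 + 1" using L1 unfolding B_def by linarith+
    have l: "real l \<ge> \<mu> / 4 - 1" "real l \<le> \<mu> / 4" using \<mu>(1) unfolding l_def by linarith+
    define n where "n = nat \<lfloor>2 powr (L powr (2 + \<alpha>) / 200)\<rfloor>"
    define m where "m = nat \<lfloor>sqrt (real r)\<rfloor>"
    have n_le: "n \<le> ((2 ^ a) ^ B) ^ l"
    proof -
      have "L powr (2 + \<alpha>) / 200 = L\<^sup>2 * \<mu> / 200"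
        using L1 by (simp add: powr_add \<mu>_def)
      also have "\<dots> \<le> L\<^sup>2 * ((\<mu> / 4 - 1) / 45)"
        using \<mu>(1) L1 unfolding times_divide_eq_right[symmetric] by (intro mult_left_mono) auto
      also have "\<dots> = (L / 9 * (L / 5)) * (\<mu> / 4 - 1)" by (simp add: power2_eq_square)
      also have "\<dots> \<le> (real a * real B) * real l"
        using a B l L1 \<mu>(1) by (intro mult_mono) auto
      finally have "2 powr (L powr (2 + \<alpha>) / 200) \<le> 2 powr real (a * B * l)"
        by (intro powr_mono) auto
      then have "2 powr (L powr (2 + \<alpha>) / 200) \<le> real (((2 ^ a) ^ B) ^ l)"
        by (subst (asm) powr_realpow) (auto simp: power_mult)
      then show ?thesis unfolding n_def by linarith
    qed
    have m_ge: "l * (B * (2 ^ a * (2 ^ a * 2 ^ B))) \<le> m"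
    proof -
      have "real (l * (B * (2 ^ a * (2 ^ a * 2 ^ B)))) = (real l * real B) * 2 powr real (a + a + B)"
        by (simp add: powr_realpow power_add del: of_nat_add)
      also have "\<dots> \<le> (L * L) * 2 powr (3 + 19 / 45 * L)"
        using a B l L1 \<mu>(1) \<mu>L by (intro mult_mono powr_mono) auto
      also have "\<dots> = 8 * L\<^sup>2 * 2 powr (19 / 45 * L)"
        by (simp add: powr_add power2_eq_square)
      also have "\<dots> \<le> 2 powr (7 / 90 * L) * 2 powr (19 / 45 * L)"
        using \<mu> \<mu>L by (intro mult_right_mono L0) auto
      also have "\<dots> = 2 powr (L * (1 / 2))"
        by (simp flip: powr_add)
      also have "\<dots> = (2 powr L) powr (1 / 2)"
        by (simp add: powr_powr)
      also have "\<dots> = sqrt (real r)"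
        using r by (simp add: L_def powr_half_sqrt)
      finally show ?thesis unfolding m_def by linarith
    qed
    from exists_layered_colouring[OF n_le m_ge] obtain col :: "nat set \<Rightarrow> nat" where col: "\<forall>e\<in>Kn_edges n. col e \<in> {1..m}"
      "\<And>I. I \<subseteq> {1..m} \<Longrightarrow> real (chromatic_number n {e \<in> Kn_edges n. col e \<in> I})
         \<le> 2 powr (6 * (sqrt l * sqrt (card I * log 2 (2 * card I))))"
      by blast
    have sqrt_l: "6 * sqrt l \<le> 3 * L powr (\<alpha> / 2)"
    proof -
      have "(L powr (\<alpha> / 2))\<^sup>2 = \<mu>"
        by (simp add: \<mu>_def power2_eq_square flip: powr_add)
      then have "(2 * sqrt l)\<^sup>2 \<le> (L powr (\<alpha> / 2))\<^sup>2"
        using l(2) by (simp add: power_mult_distrib)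
      then have "2 * sqrt l \<le> L powr (\<alpha> / 2)" by (rule power2_le_imp_le) simp
      then show ?thesis by simp
    qed
    have "real (chromatic_number n {e \<in> Kn_edges n. col e \<in> I})
        \<le> 2 powr (3 * L powr (\<alpha> / 2) * sqrt (real (card I) * log 2 (2 * real (card I))))"
      if "I \<subseteq> {1..m}" for I
    proof -
      have "card I * log 2 (2 * card I) \<ge> 0"
        by (cases "card I = 0") (auto simp: zero_le_log_cancel_iff)
      then have "6 * (sqrt l * sqrt (card I * log 2 (2 * card I)))
          \<le> 3 * L powr (\<alpha> / 2) * sqrt (card I * log 2 (2 * card I))"
        using sqrt_l unfolding mult.assoc[of 6, symmetric] by (intro mult_right_mono) auto
      then show ?thesis
        by (intro order_trans[OF col(2)[OF that]] powr_mono) auto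
    qed
    then show "let n = nat \<lfloor>2 powr ((log 2 (real r)) powr (2 + \<alpha>) / 200)\<rfloor>;
            m = nat \<lfloor>sqrt (real r)\<rfloor>
        in \<exists>col :: nat set \<Rightarrow> nat.
             (\<forall>e \<in> Kn_edges n. col e \<in> {1..m}) \<and>
             (\<forall>I \<subseteq> {1..m}.
                real (chromatic_number n {e \<in> Kn_edges n. col e \<in> I})
                  \<le> 2 powr (3 * (log 2 (real r)) powr (\<alpha> / 2)
                        * sqrt (real (card I) * log 2 (2 * real (card I)))))"
      unfolding Let_def L_def[symmetric] n_def[symmetric] m_def[symmetric]
      using col(1) by blast
  qed simp
qed

end
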